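(* Let $M$ be a multiset and set $\Theta=\rho^{-1}\circ\theta\circ\rho:\mathcal{T}_M\to\mathcal{T}_M$. For any $T\in\mathcal{T}_M$, $\Theta(T)=\widehat{T}$.
   Context: A plane tree is a rooted tree in which the children of each node are linearly ordered (from left to right). $M=\{1^{p_1},\ldots,n^{p_n}\}$ is a multiset in which $i$ has multiplicity $p_i$ ($n\ge1$, all $p_i\ge1$), with cardinality $|M|=p_1+\cdots+p_n$. A weakly increasing tree on $M$ is a plane tree with $|M|+1$ nodes labeled precisely by all elements of the multiset $M\cup\{0\}$ such that (i) the labels along a path from the root to any leaf are weakly increasing; (ii) the labels of the children of each node are weakly increasing from right to left. $\mathcal{T}_M$ is the set of weakly increasing trees on $M$. A binary tree is a rooted tree in which every node has at most one left child and at most one right child. A weakly increasing binary tree on $M$ is a binary tree whose nodes are labeled precisely by the multiset $M$ such that the labels along any path from the root to a leaf are weakly increasing; $\mathcal{B}_M$ is the set of these. The bijection $\rho:\mathcal{T}_M\to\mathcal{B}_M$: the nodes of $\rho(T)$ are the non-root nodes of $T$ (with their labels); the root of $\rho(T)$ is the rightmost child of the root of $T$; $y$ is the right child of $x$ in $\rho(T)$ iff $y$ is the rightmost child of $x$ in $T$; $y$ is the left child of $x$ in $\rho(T)$ iff $y$ is the closest sibling of $x$ to the left of $x$ in $T$. For $B\in\mathcal{B}_M$ and a node $x$ of $B$, $\phi_x(B)$ is obtained from $B$ by switching the left branch and the right branch of $x$ (either may be empty). The $\phi_x$ commute. A node is a head of $B$ if it is the root of $B$ or a right child in $B$; $H(B)$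 is the set of heads of $B$. The map $\theta:\mathcal{B}_M\to\mathcal{B}_M$ is $\theta(B)=\prod_{x\in H(B)}\phi_x(B)$ (the heads being determined in the original tree $B$). Deutsch's map $T\mapsto\widehat T$ is defined recursively on (labeled) plane trees, nodes keeping their labels: if $T$ consists of its root only, $\widehat T=T$. Otherwise let $r$ be the root of $T$, let $c$ be the rightmost child of $r$, let $u_1,\ldots,u_s$ be the other children of $r$ from right to left, let $H$ be the subtree of $T$ rooted at $c$ and $T_{u_i}$ the subtree rooted at $u_i$. Form $\widehat H$ (whose root is $c$), and let $\widehat H^*$ be $\widehat H$ with its root replaced by $r$; attach $c$ to the root $r$ of $\widehat H^*$ as its new rightmost child; then make $\widehat{T}_{u_1},\ldots,\widehat{T}_{u_s}$ the branches of $c$ from right to left. The result is $\widehat T$. (For $T\in\mathcal{T}_M$, $r$ has label $0$ and $c$ has label $1$.) *)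

theory Defs
  imports "HOL-Library.Multiset" "HOL-Library.Tree"
begin

section \<open>Plane trees\<close>

text \<open>Children are listed from left to right. A node is addressed by the list of child indices
  (counted from the left, starting with 0) on the way down from the root.\<close>

datatype 'a ptree = PNode (root_label: 'a) (children: "'a ptree list")

fun subtree_at :: "'a ptree \<Rightarrow> nat list \<Rightarrow> 'a ptree" where
  "subtree_at t [] = t"
| "subtree_at t (i # p) = subtree_at (children t ! i) p"

fun is_node :: "'a ptree \<Rightarrow> nat list \<Rightarrow> bool" where
  "is_node t [] \<longleftrightarrow> True"
| "is_node t (i # p) \<longleftrightarrow> i < length (children t) \<and> is_node (children t ! i) p"

definition nodes :: "'a ptree \<Rightarrow> nat list set" where
  "nodes t = {p. is_node t p}"

definition label_at :: "'a ptree \<Rightarrow> nat list \<Rightarrow> 'a" where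
  "label_at t p = root_label (subtree_at t p)"

fun mset_ptree :: "'a ptree \<Rightarrow> 'a multiset" where
  "mset_ptree (PNode a ts) = add_mset a (\<Sum>t\<leftarrow>ts. mset_ptree t)"

text \<open>The label sequences along the paths from the root to the leaves.\<close>

fun label_paths :: "'a ptree \<Rightarrow> 'a list set" where
  "label_paths (PNode a ts) =
     (if ts = [] then {[a]} else (#) a ` (\<Union>t\<in>set ts. label_paths t))"

text \<open>\<open>is_rightmost_child t x y\<close> and \<open>is_left_sibling t x y\<close> say that \<open>y\<close> is the rightmost child of
  \<open>x\<close>, respectively the closest sibling to the left of \<open>x\<close>.\<close>

definition is_rightmost_child :: "'a ptree \<Rightarrow> nat list \<Rightarrow> nat list \<Rightarrow> bool" where
  "is_rightmost_child t x y \<longleftrightarrow> x \<in> nodes t \<and> y \<in> nodes t \<and>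
     y = x @ [length (children (subtree_at t x)) - 1]"

definition is_left_sibling :: "'a ptree \<Rightarrow> nat list \<Rightarrow> nat list \<Rightarrow> bool" where
  "is_left_sibling t x y \<longleftrightarrow> x \<in> nodes t \<and> y \<in> nodes t \<and>
     (\<exists>p i. x = p @ [Suc i] \<and> y = p @ [i])"

text \<open>The weakly increasing trees on \<open>M\<close>; equality of the label multisets forces \<open>size M + 1\<close> nodes.\<close>

definition wi_trees :: "nat multiset \<Rightarrow> nat ptree set" where
  "wi_trees M = {T. mset_ptree T = add_mset 0 M \<and>
     (\<forall>ls\<in>label_paths T. sorted ls) \<and>
     (\<forall>p\<in>nodes T. sorted (rev (map root_label (children (subtree_at T p)))))}"


section \<open>Binary trees\<close>

text \<open>Nodes of a binary tree are addressed by the list of directions on the way down from the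
  root. The constructor \<open>Leaf\<close> is the empty tree, not a node.\<close>

datatype dir = Lft | Rgt

fun bnodes :: "'a tree \<Rightarrow> dir list set" where
  "bnodes Leaf = {}"
| "bnodes (Node l a r) = insert [] ((#) Lft ` bnodes l \<union> (#) Rgt ` bnodes r)"

fun blabel_at :: "'a tree \<Rightarrow> dir list \<Rightarrow> 'a" where
  "blabel_at (Node l a r) [] = a"
| "blabel_at (Node l a r) (d # p) = blabel_at (case d of Lft \<Rightarrow> l | Rgt \<Rightarrow> r) p"
| "blabel_at Leaf p = undefined"


section \<open>The bijection \<open>\<rho>\<close>\<close>

text \<open>The map \<open>f\<close> identifies the non-root nodes of \<open>T\<close> with the nodes of \<open>B\<close>. These conditions
  determine \<open>B\<close>.\<close>

definition is_rho :: "'a ptree \<Rightarrow> 'a tree \<Rightarrow> bool" where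
  "is_rho T B \<longleftrightarrow> (\<exists>f. bij_betw f (nodes T - {[]}) (bnodes B) \<and>
     (\<forall>x\<in>nodes T - {[]}. blabel_at B (f x) = label_at T x) \<and>
     (\<forall>x\<in>nodes T - {[]}. f x = [] \<longleftrightarrow> is_rightmost_child T [] x) \<and>
     (\<forall>x\<in>nodes T - {[]}. \<forall>y\<in>nodes T - {[]}.
        (f y = f x @ [Rgt] \<longleftrightarrow> is_rightmost_child T x y) \<and>
        (f y = f x @ [Lft] \<longleftrightarrow> is_left_sibling T x y)))"

definition rho :: "'a ptree \<Rightarrow> 'a tree" where
  "rho T = (THE B. is_rho T B)"


section \<open>The maps \<open>\<phi>\<^sub>x\<close> and \<open>\<theta>\<close>\<close>

text \<open>Switching branches moves nodes to other addresses and labels may repeat, so nodes are given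
  identities that they keep: an entry \<open>(v, a)\<close> is the node \<open>v\<close> with label \<open>a\<close>.\<close>

fun phi :: "'v \<Rightarrow> ('v \<times> 'a) tree \<Rightarrow> ('v \<times> 'a) tree" where
  "phi x Leaf = Leaf"
| "phi x (Node l (v, a) r) =
     (if v = x then Node r (v, a) l else Node (phi x l) (v, a) (phi x r))"

text \<open>The address of a node in the original tree serves as its identity.\<close>

fun with_addrs :: "dir list \<Rightarrow> 'a tree \<Rightarrow> (dir list \<times> 'a) tree" where
  "with_addrs p Leaf = Leaf"
| "with_addrs p (Node l a r) =
     Node (with_addrs (p @ [Lft]) l) (p, a) (with_addrs (p @ [Rgt]) r)"

definition heads :: "'a tree \<Rightarrow> dir list set" where
  "heads B = {x \<in> bnodes B. x = [] \<or> (\<exists>y. x = y @ [Rgt])}"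

text \<open>The maps \<open>phi x\<close> commute, so the fold is their product in any order.\<close>

definition theta :: "'a tree \<Rightarrow> 'a tree" where
  "theta B = map_tree snd (Finite_Set.fold phi (with_addrs [] B) (heads B))"

lemma phi_commute: "phi y (phi x B) = phi x (phi y B)"
  by (induction x B rule: phi.induct) auto

lemma comp_fun_commute_phi: "comp_fun_commute phi"
  by unfold_locales (auto simp: phi_commute)


section \<open>Deutsch's map\<close>

function deutsch :: "'a ptree \<Rightarrow> 'a ptree" where
  "deutsch (PNode r []) = PNode r []"
| "deutsch (PNode r (us @ [h])) =
     PNode r (children (deutsch h) @ [PNode (root_label h) (map deutsch us)])"
  by (metis ptree.exhaust rev_exhaust) auto
termination
  by (relation "measure size") (auto simp: less_Suc_eq_le intro!: le_SucI trans_le_add1 size_list_estimation')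

end

theory Submission
  imports Defs
begin

text \<open>
  The map \<open>\<rho>\<close> sees only the forest of branches of the root, and on forests it is the classical
  first-child/next-sibling encoding: a forest with rightmost tree \<open>h\<close> and other trees \<open>us\<close> becomes
  the binary tree with the label of \<open>h\<close> at its root, the encoding of \<open>us\<close> on the left and the
  encoding of the branches of \<open>h\<close> on the right (\<open>rho_eq_encode_forest\<close>).

  Switching at all heads is recursive as well, once one records whether the current root counts as
  a head: a head exchanges its branches, any other node leaves them in place, a former left child
  is not a head and a former right child is one (\<open>theta_eq_switch_heads\<close>).

  In this form both maps follow the same recursion. For a head \<open>h\<close>, with siblings \<open>us\<close> to its
  left, the switch moves the branches of \<open>h\<close> to the left of \<open>h\<close>, so that they become siblings,
  and \<open>us\<close> to the right, so that they become branches; this is exactly how Deutsch's map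
  rearranges a tree. For a forest whose root is not a head the switch acts on each tree separately,
  which matches the application of Deutsch's map to all members of \<open>us\<close>. Hence
  \<open>\<theta> (\<rho> T) = \<rho> (deutsch T)\<close> holds for every plane tree (\<open>switch_heads_encode_forest\<close>).

  It remains to cancel \<open>\<rho>\<close>. The encoding of forests is injective, and \<open>\<rho>\<close> loses only the label of
  the root, which is \<open>0\<close> in every weakly increasing tree (\<open>inj_on_rho_wi_trees\<close>); and Deutsch's map
  preserves weakly increasing trees (\<open>deutsch_in_wi_trees\<close>).
\<close>


section \<open>The recursive form of \<open>\<rho>\<close>\<close>

function encode_forest :: "'a ptree list \<Rightarrow> 'a tree" where
  "encode_forest [] = Leaf"
| "encode_forest (us @ [h]) =
     Node (encode_forest us) (root_label h) (encode_forest (children h))"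
  by (metis rev_exhaust) auto
termination
proof (relation "measure (size_list size)")
  fix us :: "'a ptree list" and h
  show "(children h, us @ [h]) \<in> measure (size_list size)"
    by (cases h) simp
qed simp_all

text \<open>
  The address in the encoding of a forest of the node with address \<open>i # p\<close>: one step to the left
  for each sibling to the right of tree \<open>i\<close>, then one step to the right to enter its branches.
  The value at \<open>[]\<close>, which addresses no node of a forest, is arbitrary.
\<close>

fun encode_addr :: "'a ptree list \<Rightarrow> nat list \<Rightarrow> dir list" where
  "encode_addr ts [] = []"
| "encode_addr ts (i # p) = replicate (length ts - Suc i) Lft @
     (if p = [] then [] else Rgt # encode_addr (children (ts ! i)) p)"

definition forest_nodes :: "'a ptree list \<Rightarrow> nat list set" where
  "forest_nodes ts = {i # p |i p. i < length ts \<and> is_node (ts ! i) p}"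

lemma forest_nodes_Nil [simp]: "forest_nodes [] = {}"
  by (auto simp: forest_nodes_def)

lemma Nil_notin_forest_nodes [simp]: "[] \<notin> forest_nodes ts"
  by (auto simp: forest_nodes_def)

lemma nodes_minus_root: "nodes T - {[]} = forest_nodes (children T)"
proof (intro set_eqI iffI)
  fix x assume "x \<in> nodes T - {[]}"
  then show "x \<in> forest_nodes (children T)"
    by (cases x) (auto simp: nodes_def forest_nodes_def)
qed (auto simp: nodes_def forest_nodes_def)

lemma is_node_iff: "is_node t p \<longleftrightarrow> p = [] \<or> p \<in> forest_nodes (children t)"
  by (cases p) (auto simp: forest_nodes_def)

lemma forest_nodes_snoc:
  "forest_nodes (us @ [h]) =
     insert [length us] (forest_nodes us \<union> (#) (length us) ` forest_nodes (children h))"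
  (is "?L = ?R")
proof (intro set_eqI iffI)
  fix x assume "x \<in> ?L"
  then obtain i p where x: "x = i # p" "i < Suc (length us)" "is_node ((us @ [h]) ! i) p"
    by (auto simp: forest_nodes_def)
  show "x \<in> ?R"
  proof (cases "i < length us")
    case True
    then show ?thesis using x by (auto simp: forest_nodes_def nth_append)
  next
    case False
    then have "i = length us" using x by simp
    then show ?thesis using x by (auto simp: is_node_iff)
  qed
next
  fix x assume "x \<in> ?R"
  then show "x \<in> ?L"
    by (auto simp: forest_nodes_def nth_append)
qed

lemma encode_addr_snoc_left:
  "x \<in> forest_nodes us \<Longrightarrow> encode_addr (us @ [h]) x = Lft # encode_addr us x"
  by (auto simp: forest_nodes_def nth_append Suc_diff_Suc simp flip: replicate_Suc)

lemma encode_addr_snoc_last: "encode_addr (us @ [h]) [length us] = []"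
  by simp

lemma encode_addr_snoc_right:
  "x \<in> forest_nodes (children h) \<Longrightarrow>
     encode_addr (us @ [h]) (length us # x) = Rgt # encode_addr (children h) x"
  by (auto simp: nth_append)

lemma bij_betw_encode_addr:
  "bij_betw (encode_addr ts) (forest_nodes ts) (bnodes (encode_forest ts))"
proof (induction ts rule: encode_forest.induct)
  case 1
  then show ?case by (simp add: bij_betw_def)
next
  case (2 us h)
  let ?f = "encode_addr (us @ [h])"
  have inj: "inj_on (encode_addr us) (forest_nodes us)"
    "inj_on (encode_addr (children h)) (forest_nodes (children h))"
    and im: "bnodes (encode_forest us) = encode_addr us ` forest_nodes us"
    "bnodes (encode_forest (children h)) =
       encode_addr (children h) ` forest_nodes (children h)"
    using 2 by (simp_all add: bij_betw_def)
  have "inj_on ?f (forest_nodes (us @ [h]))"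
  proof (rule inj_onI)
    fix x y assume "x \<in> forest_nodes (us @ [h])" "y \<in> forest_nodes (us @ [h])" "?f x = ?f y"
    then show "x = y"
      unfolding forest_nodes_snoc
      using inj_onD[OF inj(1)] inj_onD[OF inj(2)]
      by (auto simp: encode_addr_snoc_left encode_addr_snoc_right
          simp del: encode_addr.simps simp add: encode_addr_snoc_last)
  qed
  moreover have "?f ` forest_nodes (us @ [h]) = bnodes (encode_forest (us @ [h]))"
    unfolding forest_nodes_snoc
    by (simp add: image_Un image_image im encode_addr_snoc_last encode_addr_snoc_left
        encode_addr_snoc_right del: encode_addr.simps cong: image_cong)
  ultimately show ?case by (simp add: bij_betw_def)
qed

lemma blabel_at_encode_addr:
  "x \<in> forest_nodes ts \<Longrightarrow>
     blabel_at (encode_forest ts) (encode_addr ts x) = label_at (PNode r ts) x"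
proof (induction ts arbitrary: x r rule: encode_forest.induct)
  case 1
  then show ?case by simp
next
  case (2 us h)
  from "2.prems" consider "x = [length us]" | "x \<in> forest_nodes us"
    | y where "x = length us # y" "y \<in> forest_nodes (children h)"
    unfolding forest_nodes_snoc by blast
  then show ?case
  proof cases
    case 1
    then show ?thesis by (simp add: label_at_def)
  next
    case 2
    then have "label_at (PNode r (us @ [h])) x = label_at (PNode r us) x"
      by (auto simp: forest_nodes_def label_at_def nth_append)
    with 2 "2.IH"(1)[OF 2] show ?thesis
      by (simp add: encode_addr_snoc_left)
  next
    case 3
    then have "label_at (PNode r (us @ [h])) x = label_at h y"
      by (simp add: label_at_def)
    then show ?thesis
      using 3 "2.IH"(2)[OF 3(2), of "root_label h"]
      by (simp add: encode_addr_snoc_right del: encode_addr.simps)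
  qed
qed

text \<open>
  Seen from the last step of an address, \<open>encode_addr\<close> first goes to the right child of the parent
  (or to the root, if the parent is the root of the plane tree) and then to the left, once for each
  sibling to the right. Hence the rightmost children are the nodes whose address does not end with
  \<open>Lft\<close>.
\<close>

lemma encode_addr_snoc:
  "encode_addr ts (z @ [j]) = (if z = [] then [] else encode_addr ts z @ [Rgt]) @
     replicate (length (children (subtree_at (PNode r ts) z)) - Suc j) Lft"
proof (induction z arbitrary: ts r)
  case Nil
  then show ?case by simp
next
  case (Cons i z)
  then show ?case
    using Cons.IH[of "children (ts ! i)" "root_label (ts ! i)"] by simp
qed

lemma is_node_snoc:
  "is_node t (z @ [j]) \<longleftrightarrow> is_node t z \<and> j < length (children (subtree_at t z))"
  by (induction z arbitrary: t) auto

text \<open>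
  In the equivalences that define \<open>\<rho>\<close>, the direction from plane trees to addresses is a computation.
  For the converse, the last direction of the address of \<open>y\<close> tells whether \<open>y\<close> is a rightmost child,
  and the rest is then the address of the parent of \<open>y\<close> or of its next sibling to the right; as
  addresses are injective, that node is \<open>x\<close>.
\<close>

lemma is_rho_encode_forest: "is_rho (PNode r ts) (encode_forest ts)"
proof -
  let ?T = "PNode r ts" and ?f = "encode_addr ts"
  let ?deg = "\<lambda>z. length (children (subtree_at ?T z))"
  have N: "nodes ?T - {[]} = forest_nodes ts"
    using nodes_minus_root[of ?T] by simp
  have snoc: "\<exists>z j. x = z @ [j] \<and> z \<in> nodes ?T \<and> j < ?deg z" if "x \<in> forest_nodes ts" for x
  proof -
    have "x \<in> nodes ?T" "x \<noteq> []" using that N by blast+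
    then show ?thesis
      by (cases x rule: rev_exhaust) (simp_all add: nodes_def is_node_snoc)
  qed
  have inj: "x = y" if "?f x = ?f y" "x \<in> forest_nodes ts" "y \<in> forest_nodes ts" for x y
    using bij_betw_encode_addr[of ts] that by (auto simp: bij_betw_def dest: inj_onD)
  have "?f x = [] \<longleftrightarrow> is_rightmost_child ?T [] x" if "x \<in> forest_nodes ts" for x
  proof -
    from snoc[OF that] obtain z j where x: "x = z @ [j]" "z \<in> nodes ?T" "j < ?deg z"
      by blast
    then show ?thesis
      by (auto simp: encode_addr_snoc[of _ _ _ r] is_rightmost_child_def nodes_def is_node_snoc
          simp del: encode_addr.simps)
  qed
  moreover have "?f y = ?f x @ [Rgt] \<longleftrightarrow> is_rightmost_child ?T x y"
    if xy: "x \<in> forest_nodes ts" "y \<in> forest_nodes ts" for x y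
  proof -
    from snoc[OF xy(2)] obtain z j where y: "y = z @ [j]" "z \<in> nodes ?T" "j < ?deg z"
      by blast
    have x: "x \<noteq> []" "x \<in> nodes ?T" and ynode: "y \<in> nodes ?T" using xy N by blast+
    show ?thesis
    proof
      assume eq: "?f y = ?f x @ [Rgt]"
      \<comment> \<open>a further step to the left would make the last direction \<open>Lft\<close>\<close>
      have j: "?deg z - Suc j = 0"
      proof (rule ccontr)
        assume "?deg z - Suc j \<noteq> 0"
        then obtain k where "?deg z - Suc j = Suc k" by (cases "?deg z - Suc j") auto
        then show False using eq
          by (simp add: y encode_addr_snoc[of _ _ _ r] replicate_append_same[symmetric]
              del: encode_addr.simps)
      qed
      with eq have "z \<noteq> []" "?f z = ?f x"
        by (auto simp: y encode_addr_snoc[of _ _ _ r] split: if_splits)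
      then have "z = x" using inj xy(1) y(2) N by blast
      then show "is_rightmost_child ?T x y"
        using j y x ynode by (auto simp: is_rightmost_child_def)
    next
      assume "is_rightmost_child ?T x y"
      then show "?f y = ?f x @ [Rgt]"
        using x by (auto simp: is_rightmost_child_def encode_addr_snoc[of _ _ _ r])
    qed
  qed
  moreover have "?f y = ?f x @ [Lft] \<longleftrightarrow> is_left_sibling ?T x y"
    if xy: "x \<in> forest_nodes ts" "y \<in> forest_nodes ts" for x y
  proof -
    from snoc[OF xy(2)] obtain z j where y: "y = z @ [j]" "z \<in> nodes ?T" "j < ?deg z"
      by blast
    have xy': "x \<in> nodes ?T" "y \<in> nodes ?T" using xy N by blast+
    show ?thesis
    proof
      assume eq: "?f y = ?f x @ [Lft]"
      \<comment> \<open>without a step to the left, the address would be empty or end with \<open>Rgt\<close>\<close>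
      have "?deg z - Suc j \<noteq> 0"
        using eq by (auto simp: y encode_addr_snoc[of _ _ _ r] split: if_splits)
      then have j: "Suc j < ?deg z" by simp
      then have "replicate (?deg z - Suc j) Lft = replicate (?deg z - Suc (Suc j)) Lft @ [Lft]"
        by (simp add: Suc_diff_Suc replicate_append_same flip: replicate_Suc)
      then have "?f (z @ [Suc j]) @ [Lft] = ?f y"
        by (simp add: y encode_addr_snoc[of _ _ _ r])
      then have "?f (z @ [Suc j]) = ?f x" using eq by simp
      moreover have "z @ [Suc j] \<in> nodes ?T"
        using j y(2) by (simp add: nodes_def is_node_snoc)
      then have "z @ [Suc j] \<in> forest_nodes ts" using N by blast
      ultimately have "x = z @ [Suc j]" using inj xy by metis
      then show "is_left_sibling ?T x y"
        using y xy' by (auto simp: is_left_sibling_def)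
    next
      assume "is_left_sibling ?T x y"
      then obtain p i where p: "x = p @ [Suc i]" "y = p @ [i]"
        by (auto simp: is_left_sibling_def)
      with xy' have "Suc i < ?deg p" by (simp add: nodes_def is_node_snoc)
      then have "replicate (?deg p - Suc i) Lft = replicate (?deg p - Suc (Suc i)) Lft @ [Lft]"
        by (simp add: Suc_diff_Suc replicate_append_same flip: replicate_Suc)
      then show "?f y = ?f x @ [Lft]"
        by (simp add: p encode_addr_snoc[of _ _ _ r])
    qed
  qed
  ultimately show ?thesis
    unfolding is_rho_def N
    using bij_betw_encode_addr[of ts] blabel_at_encode_addr[of _ ts r] by blast
qed

lemma bnodes_snocD: "q @ [d] \<in> bnodes B \<Longrightarrow> q \<in> bnodes B"
proof (induction q arbitrary: B)
  case Nil
  then show ?case by (cases B) auto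
next
  case (Cons e q)
  then show ?case by (cases B) auto
qed

lemma tree_eqI_addrs:
  "bnodes B = bnodes C \<Longrightarrow> (\<And>p. p \<in> bnodes B \<Longrightarrow> blabel_at B p = blabel_at C p) \<Longrightarrow> B = C"
proof (induction B arbitrary: C)
  case Leaf
  then show ?case by (cases C) auto
next
  case (Node l a r)
  then obtain l' a' r' where C: "C = Node l' a' r'"
    by (cases C) auto
  have mem: "p \<in> bnodes l \<longleftrightarrow> Lft # p \<in> bnodes (Node l a r)"
    "p \<in> bnodes l' \<longleftrightarrow> Lft # p \<in> bnodes C"
    "p \<in> bnodes r \<longleftrightarrow> Rgt # p \<in> bnodes (Node l a r)"
    "p \<in> bnodes r' \<longleftrightarrow> Rgt # p \<in> bnodes C" for p
    by (auto simp: C)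
  have "l = l'"
  proof (rule Node.IH(1))
    show "bnodes l = bnodes l'" using mem Node.prems(1) by blast
    show "blabel_at l p = blabel_at l' p" if "p \<in> bnodes l" for p
      using Node.prems(2)[of "Lft # p"] that by (simp add: C)
  qed
  moreover have "r = r'"
  proof (rule Node.IH(2))
    show "bnodes r = bnodes r'" using mem Node.prems(1) by blast
    show "blabel_at r p = blabel_at r' p" if "p \<in> bnodes r" for p
      using Node.prems(2)[of "Rgt # p"] that by (simp add: C)
  qed
  moreover have "a = a'" using Node.prems(2)[of "[]"] by (simp add: C)
  ultimately show ?case by (simp add: C)
qed

text \<open>
  The conditions on \<open>\<rho>\<close> fix the address of each node: walking down from the root of the binary
  tree, each step prescribes which node of the plane tree comes next. So two solutions have the
  same addresses with the same labels.
\<close>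

lemma is_rho_unique:
  assumes "is_rho T B" "is_rho T C"
  shows "B = C"
proof -
  let ?N = "nodes T - {[]}"
  obtain f where f: "bij_betw f ?N (bnodes B)"
    "\<forall>x\<in>?N. blabel_at B (f x) = label_at T x"
    "\<forall>x\<in>?N. f x = [] \<longleftrightarrow> is_rightmost_child T [] x"
    "\<forall>x\<in>?N. \<forall>y\<in>?N. (f y = f x @ [Rgt] \<longleftrightarrow> is_rightmost_child T x y) \<and>
       (f y = f x @ [Lft] \<longleftrightarrow> is_left_sibling T x y)"
    using assms(1) unfolding is_rho_def by (elim exE conjE) (rule that)
  obtain g where g: "bij_betw g ?N (bnodes C)"
    "\<forall>x\<in>?N. blabel_at C (g x) = label_at T x"
    "\<forall>x\<in>?N. g x = [] \<longleftrightarrow> is_rightmost_child T [] x"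
    "\<forall>x\<in>?N. \<forall>y\<in>?N. (g y = g x @ [Rgt] \<longleftrightarrow> is_rightmost_child T x y) \<and>
       (g y = g x @ [Lft] \<longleftrightarrow> is_left_sibling T x y)"
    using assms(2) unfolding is_rho_def by (elim exE conjE) (rule that)
  have fg: "f x = q \<Longrightarrow> g x = q" if "x \<in> ?N" for x q
    using that
  proof (induction q arbitrary: x rule: rev_induct)
    case Nil
    then show ?case using f(3) g(3) by blast
  next
    case (snoc d q)
    have "q @ [d] \<in> bnodes B"
      using snoc.prems f(1) by (metis bij_betwE)
    then have "q \<in> bnodes B" by (rule bnodes_snocD)
    then obtain z where z: "z \<in> ?N" "f z = q"
      using f(1) by (metis bij_betw_imp_surj_on imageE)
    then have "g z = q" using snoc.IH by blast
    then show ?case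
      using f(4)[rule_format, OF z(1) snoc.prems(2)] g(4)[rule_format, OF z(1) snoc.prems(2)]
        snoc.prems(1) z(2)
      by (cases d) simp_all
  qed
  then have "f ` ?N = g ` ?N" by (metis (no_types, lifting) image_cong)
  then have nodes: "bnodes B = bnodes C"
    using f(1) g(1) by (simp add: bij_betw_def)
  show ?thesis
  proof (rule tree_eqI_addrs[OF nodes])
    fix p assume "p \<in> bnodes B"
    then obtain x where "x \<in> ?N" "f x = p"
      using f(1) by (metis bij_betw_imp_surj_on imageE)
    then show "blabel_at B p = blabel_at C p"
      using f(2) g(2) fg by metis
  qed
qed

lemma rho_eq_encode_forest: "rho T = encode_forest (children T)"
  unfolding rho_def
  using is_rho_encode_forest[of "root_label T" "children T"]
  by (intro the_equality) (auto intro: is_rho_unique)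

lemma encode_forest_inject: "encode_forest ts = encode_forest ts' \<Longrightarrow> ts = ts'"
proof (induction ts arbitrary: ts' rule: encode_forest.induct)
  case 1
  then show ?case by (cases ts' rule: rev_exhaust) auto
next
  case (2 us h)
  then obtain us' h' where ts': "ts' = us' @ [h']"
    by (cases ts' rule: rev_exhaust) auto
  with 2 have "us = us'" "root_label h = root_label h'" "children h = children h'"
    by auto
  then show ?case by (simp add: ts' ptree.expand)
qed


section \<open>The recursive form of \<open>\<theta>\<close>\<close>

text \<open>The flag says whether the root counts as a head.\<close>

fun switch_heads :: "bool \<Rightarrow> 'a tree \<Rightarrow> 'a tree" where
  "switch_heads h Leaf = Leaf"
| "switch_heads h (Node l a r) =
     (if h then Node (switch_heads True r) a (switch_heads False l)
      else Node (switch_heads False l) a (switch_heads True r))"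

fun switch_at :: "'v set \<Rightarrow> ('v \<times> 'a) tree \<Rightarrow> ('v \<times> 'a) tree" where
  "switch_at S Leaf = Leaf"
| "switch_at S (Node l (v, a) r) =
     (if v \<in> S then Node (switch_at S r) (v, a) (switch_at S l)
      else Node (switch_at S l) (v, a) (switch_at S r))"

lemma switch_at_empty: "switch_at {} t = t"
  by (induction "{} :: 'a set" t rule: switch_at.induct) auto

lemma switch_at_insert_notin:
  "x \<notin> fst ` set_tree t \<Longrightarrow> switch_at (insert x S) t = switch_at S t"
  by (induction S t rule: switch_at.induct) auto

text \<open>
  Identities must be distinct here, because \<open>phi x\<close> does not look for \<open>x\<close> below the first node that
  it finds.
\<close>

lemma phi_switch_at:
  assumes "x \<notin> S" "distinct (map fst (inorder t))"
  shows "phi x (switch_at S t) = switch_at (insert x S) t"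
  using assms
proof (induction S t rule: switch_at.induct)
  case (2 S l v a r)
  show ?case
  proof (cases "v = x")
    case True
    with 2 have "x \<notin> fst ` set_tree l" "x \<notin> fst ` set_tree r"
      by auto
    with True 2 show ?thesis by (simp add: switch_at_insert_notin)
  next
    case False
    with 2 show ?thesis by simp
  qed
qed simp

lemma fold_phi_eq_switch_at:
  assumes "finite S" "distinct (map fst (inorder t))"
  shows "Finite_Set.fold phi t S = switch_at S t"
  using assms(1)
proof (induction S rule: finite_induct)
  case empty
  then show ?case by (simp add: switch_at_empty)
next
  case (insert x S)
  interpret comp_fun_commute phi by (rule comp_fun_commute_phi)
  from insert show ?case
    by (simp add: phi_switch_at[OF _ assms(2)])
qed

lemma ids_with_addrs: "fst ` set_tree (with_addrs p B) = (@) p ` bnodes B"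
  by (induction p B rule: with_addrs.induct) (auto simp: image_Un image_image)

lemma distinct_ids_with_addrs: "distinct (map fst (inorder (with_addrs p B)))"
proof (induction p B rule: with_addrs.induct)
  case (2 p l a r)
  have "set (map fst (inorder (with_addrs q B))) = (@) q ` bnodes B" for q and B :: "'a tree"
    by (simp add: ids_with_addrs)
  with 2 show ?case by auto
qed simp

lemma finite_bnodes: "finite (bnodes B)"
  by (induction B) auto

lemma switch_at_with_addrs:
  assumes "\<And>q d. q @ [d] \<in> bnodes B \<Longrightarrow> p @ q @ [d] \<in> S \<longleftrightarrow> d = Rgt"
  shows "map_tree snd (switch_at S (with_addrs p B)) = switch_heads (p \<in> S) B"
  using assms
proof (induction p B rule: with_addrs.induct)
  case (2 p l a r)
  have l: "map_tree snd (switch_at S (with_addrs (p @ [Lft]) l)) = switch_heads False l"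
  proof (cases l)
    case (Node l1 b r1)
    then have "p @ [Lft] \<notin> S" using "2.prems"[of "[]" Lft] by simp
    moreover have "(p @ [Lft]) @ q @ [d] \<in> S \<longleftrightarrow> d = Rgt" if "q @ [d] \<in> bnodes l" for q d
      using "2.prems"[of "Lft # q" d] that by simp
    ultimately show ?thesis using "2.IH"(1) by simp
  qed simp
  have r: "map_tree snd (switch_at S (with_addrs (p @ [Rgt]) r)) = switch_heads True r"
  proof (cases r)
    case (Node l1 b r1)
    then have "p @ [Rgt] \<in> S" using "2.prems"[of "[]" Rgt] by simp
    moreover have "(p @ [Rgt]) @ q @ [d] \<in> S \<longleftrightarrow> d = Rgt" if "q @ [d] \<in> bnodes r" for q d
      using "2.prems"[of "Rgt # q" d] that by simp
    ultimately show ?thesis using "2.IH"(2) by simp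
  qed simp
  show ?case by (simp add: l r)
qed simp

lemma theta_eq_switch_heads: "theta B = switch_heads True B"
proof -
  have "finite (heads B)" by (simp add: heads_def finite_bnodes)
  then have "theta B = map_tree snd (switch_at (heads B) (with_addrs [] B))"
    by (simp add: theta_def fold_phi_eq_switch_at distinct_ids_with_addrs)
  also have "\<dots> = switch_heads ([] \<in> heads B) B"
    by (rule switch_at_with_addrs) (auto simp: heads_def)
  also have "\<dots> = switch_heads True B"
    by (cases B) (auto simp: heads_def)
  finally show ?thesis .
qed


section \<open>Deutsch's map is the switch at all heads\<close>

lemma root_label_deutsch [simp]: "root_label (deutsch t) = root_label t"
  by (cases t rule: deutsch.cases) auto

text \<open>
  If the root is not a head, the roots of the trees of the forest stay in place, and only their
  forests of branches are changed.
\<close>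

lemma switch_heads_False_encode_forest:
  assumes "\<And>u. u \<in> set us \<Longrightarrow>
    switch_heads True (encode_forest (children u)) = encode_forest (children (deutsch u))"
  shows "switch_heads False (encode_forest us) = encode_forest (map deutsch us)"
  using assms by (induction us rule: rev_induct) auto

lemma switch_heads_encode_forest:
  "switch_heads True (encode_forest (children t)) = encode_forest (children (deutsch t))"
proof (induction t rule: deutsch.induct)
  case (2 r us h)
  then show ?case
    using switch_heads_False_encode_forest[of us] by simp
qed simp


section \<open>Weakly increasing trees\<close>

fun weakly_increasing :: "'a::linorder ptree \<Rightarrow> bool" where
  "weakly_increasing (PNode a ts) \<longleftrightarrow>
     sorted (rev (map root_label ts)) \<and> (\<forall>t\<in>set ts. a \<le> root_label t \<and> weakly_increasing t)"

lemma label_paths_nonempty: "label_paths t \<noteq> {}"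
  by (induction t) auto

lemma label_paths_hd: "ls \<in> label_paths t \<Longrightarrow> \<exists>ls'. ls = root_label t # ls'"
  by (cases t) (auto split: if_splits)

lemma sorted_label_paths_PNode:
  "(\<forall>ls\<in>label_paths (PNode a ts). sorted ls) \<longleftrightarrow>
     (\<forall>t\<in>set ts. a \<le> root_label t \<and> (\<forall>ls\<in>label_paths t. sorted ls))"
proof (cases "ts = []")
  case False
  have "(\<forall>ls\<in>label_paths t. sorted (a # ls)) \<longleftrightarrow>
      a \<le> root_label t \<and> (\<forall>ls\<in>label_paths t. sorted ls)" for t
  proof
    assume *: "\<forall>ls\<in>label_paths t. sorted (a # ls)"
    obtain ls where "ls \<in> label_paths t" using label_paths_nonempty by blast
    with * show "a \<le> root_label t \<and> (\<forall>ls\<in>label_paths t. sorted ls)"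
      using label_paths_hd[of ls t] by auto
  next
    assume "a \<le> root_label t \<and> (\<forall>ls\<in>label_paths t. sorted ls)"
    then show "\<forall>ls\<in>label_paths t. sorted (a # ls)"
      by (fastforce dest: label_paths_hd)
  qed
  with False show ?thesis by auto
qed simp

lemma all_nodes_PNode:
  "(\<forall>p\<in>nodes (PNode a ts). P (subtree_at (PNode a ts) p)) \<longleftrightarrow>
     P (PNode a ts) \<and> (\<forall>t\<in>set ts. \<forall>p\<in>nodes t. P (subtree_at t p))" (is "?L \<longleftrightarrow> ?R")
proof
  assume L: ?L
  have "P (subtree_at t p)" if "t \<in> set ts" "p \<in> nodes t" for t p
  proof -
    from that obtain i where "i < length ts" "ts ! i = t" by (auto simp: in_set_conv_nth)
    with that L[rule_format, of "i # p"] show ?thesis by (simp add: nodes_def)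
  qed
  with L[rule_format, of "[]"] show ?R by (simp add: nodes_def)
next
  assume R: ?R
  show ?L
  proof
    fix p assume "p \<in> nodes (PNode a ts)"
    with R show "P (subtree_at (PNode a ts) p)" by (cases p) (auto simp: nodes_def)
  qed
qed

lemma weakly_increasing_iff:
  "weakly_increasing T \<longleftrightarrow> (\<forall>ls\<in>label_paths T. sorted ls) \<and>
     (\<forall>p\<in>nodes T. sorted (rev (map root_label (children (subtree_at T p)))))"
proof (induction T)
  case (PNode a ts)
  then show ?case
    unfolding sorted_label_paths_PNode
      all_nodes_PNode[where P = "\<lambda>t. sorted (rev (map root_label (children t)))"]
    by auto
qed

lemma wi_trees_iff: "T \<in> wi_trees M \<longleftrightarrow> mset_ptree T = add_mset 0 M \<and> weakly_increasing T"
  by (simp add: wi_trees_def weakly_increasing_iff)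

lemma root_label_le:
  "weakly_increasing t \<Longrightarrow> x \<in># mset_ptree t \<Longrightarrow> root_label t \<le> x"
proof (induction t)
  case (PNode a ts)
  then show ?case by (fastforce intro: order_trans)
qed

lemma wi_trees_root_label:
  assumes "T \<in> wi_trees M"
  shows "root_label T = 0"
  using assms root_label_le[of T 0] by (simp add: wi_trees_iff)

lemma inj_on_rho_wi_trees: "inj_on rho (wi_trees M)"
  by (rule inj_onI)
    (metis encode_forest_inject ptree.expand rho_eq_encode_forest wi_trees_root_label)

lemma mset_ptree_deutsch: "mset_ptree (deutsch t) = mset_ptree t"
proof (induction t rule: deutsch.induct)
  case (2 r us h)
  have root: "mset_ptree t = add_mset (root_label t) (\<Sum>s\<leftarrow>children t. mset_ptree s)"
    for t :: "'a ptree"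
    by (cases t) simp
  have "(\<Sum>u\<leftarrow>us. mset_ptree (deutsch u)) = (\<Sum>u\<leftarrow>us. mset_ptree u)"
    using 2 by (metis (no_types, lifting) map_eq_conv)
  moreover have "mset_ptree h =
      add_mset (root_label h) (\<Sum>s\<leftarrow>children (deutsch h). mset_ptree s)"
    using "2.IH"(1) root[of "deutsch h"] by simp
  ultimately show ?case by (simp add: o_def)
qed simp

text \<open>
  The label of the rightmost child \<open>h\<close> is at most the labels of its siblings and of the nodes
  below it. So it can become the parent of its siblings and the rightmost sibling of its former
  descendants.
\<close>

lemma weakly_increasing_deutsch: "weakly_increasing t \<Longrightarrow> weakly_increasing (deutsch t)"
proof (induction t rule: deutsch.induct)
  case (2 r us h)
  have iff: "weakly_increasing t \<longleftrightarrow> sorted (rev (map root_label (children t))) \<and>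
      (\<forall>s\<in>set (children t). root_label t \<le> root_label s \<and> weakly_increasing s)"
    for t :: "'a ptree"
    by (cases t) simp
  have h: "weakly_increasing (deutsch h)" and us: "\<forall>u\<in>set us. weakly_increasing (deutsch u)"
    using 2 by auto
  have "weakly_increasing (PNode (root_label h) (map deutsch us))"
    using us "2.prems" by (auto simp: o_def rev_map)
  moreover have "r \<le> root_label h" using "2.prems" by simp
  ultimately show ?case
    using h unfolding iff[of "deutsch h"] by (auto simp: rev_map)
qed simp

lemma deutsch_in_wi_trees: "T \<in> wi_trees M \<Longrightarrow> deutsch T \<in> wi_trees M"
  by (simp add: wi_trees_iff mset_ptree_deutsch weakly_increasing_deutsch)


section \<open>Deutsch's map as a conjugate of \<open>\<theta>\<close>\<close>

theorem theorem2p13: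
  fixes M :: "nat multiset" and n :: nat and T :: "nat ptree"
  assumes "n \<ge> 1" and "set_mset M = {1..n}"
    and "T \<in> wi_trees M"
  shows "(inv_into (wi_trees M) rho \<circ> theta \<circ> rho) T = deutsch T"
proof -
  have "theta (rho T) = rho (deutsch T)"
    by (simp add: rho_eq_encode_forest theta_eq_switch_heads switch_heads_encode_forest)
  then show ?thesis
    using assms(3) by (simp add: inv_into_f_f[OF inj_on_rho_wi_trees] deutsch_in_wi_trees)
qed

end
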